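(* Consider the two-settlement storage arbitrage setting described in the context, with day-ahead decisions $x^{\mathrm{D}}=(p_t^{\mathrm{D}},b_t^{\mathrm{D}})_{t\in\mathcal{T}}\in\mathcal{A}^{\mathrm{D}}$ and real-time decisions $x^{\mathrm{R}}=(p_s^{\mathrm{R}},b_s^{\mathrm{R}})_{s\in\mathcal{S}}\in\mathcal{A}^{\mathrm{R}}$, under the price-taker assumption. Then the joint problem $$\sup_{(x^{\mathrm{D}},x^{\mathrm{R}})\in\mathcal{A}^{\mathrm{D}}\times\mathcal{A}^{\mathrm{R}}}\ \mathbb{E}\Big\{\sum_{t\in\mathcal{T}}\lambda_t\,(p_t^{\mathrm{D}}-b_t^{\mathrm{D}})-\sum_{s\in\mathcal{S}}c\,p_s^{\mathrm{R}}+\sum_{s\in\mathcal{S}}\pi_s\Big(p_s^{\mathrm{R}}-b_s^{\mathrm{R}}-\frac{p_{\tau(s)}^{\mathrm{D}}}{S}+\frac{b_{\tau(s)}^{\mathrm{D}}}{S}\Big)\Big\}$$ and the decomposed problem $$\sup_{x^{\mathrm{D}}\in\mathcal{A}^{\mathrm{D}}}\ \mathbb{E}\Big\{\sum_{t\in\mathcal{T}}\big[\lambda_t\,(p_t^{\mathrm{D}}-b_t^{\mathrm{D}})-\overline{\pi}_t\,(p_t^{\mathrm{D}}-b_t^{\mathrm{D}})\big]\Big\}\;+\;\sup_{x^{\mathrm{R}}\in\mathcal{A}^{\mathrm{R}}}\ \mathbb{E}\Big\{\sum_{s\in\mathcal{S}}\pi_s\,(p_s^{\mathrm{R}}-b_s^{\mathrm{R}})-\sum_{s\in\mathcal{S}}c\,p_s^{\mathrm{R}}\Big\}$$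 are equivalent: they have the same optimal value, and a pair $(x^{\mathrm{D}},x^{\mathrm{R}})\in\mathcal{A}^{\mathrm{D}}\times\mathcal{A}^{\mathrm{R}}$ is optimal for the joint problem if and only if $x^{\mathrm{D}}$ is optimal for the first (day-ahead) problem and $x^{\mathrm{R}}$ is optimal for the second (real-time) problem of the decomposition.
   Context: Markets. $\mathcal{T}$ is the finite (ordered) set of day-ahead hours of one day and $\mathcal{S}$ the finite (ordered) set of real-time clearing intervals of the day; each hour contains exactly $S\ge1$ intervals, and $\tau(s)\in\mathcal{T}$ is the hour containing interval $s$. $\bm{\lambda}=(\lambda_t)_{t\in\mathcal{T}}$ are the day-ahead prices and $\bm{\pi}=(\pi_s)_{s\in\mathcal{S}}$ the real-time prices: integrable random variables on a common probability space, with expectation $\mathbb{E}$. $\overline{\pi}_t=\mathbb{E}\big[\tfrac1S\sum_{s:\,\tau(s)=t}\pi_s\big]$ is the expected hourly average real-time price. $c$ is a constant discharge cost. Storage. $P>0$ is the power rating, $E>0$ the energy capacity, $\eta\in(0,1]$ the one-way efficiency; initial states of charge $e_0^{\mathrm{D}},e_0^{\mathrm{R}}\in[0,E]$ are given. $p_t^{\mathrm{D}},b_t^{\mathrm{D}}$ are the day-ahead cleared discharging and charging energies; $p_s^{\mathrm{R}},b_s^{\mathrm{R}}$ are the physical real-time discharging and charging energies. The bidding requirement is relaxed, so these energies are direct decision variables (random variables, possibly deterministic). Constraints (holding almost surely). Day-ahead: $0\le p_t^{\mathrm{D}},b_t^{\mathrm{D}}\le P$; $e_t^{\mathrm{D}}-e_{t-1}^{\mathrm{D}}=-p_t^{\mathrm{D}}/\eta+b_t^{\mathrm{D}}\eta$;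 $0\le e_t^{\mathrm{D}}\le E$, for all $t\in\mathcal{T}$. Real-time: $0\le p_s^{\mathrm{R}},b_s^{\mathrm{R}}\le P/S$; $e_s^{\mathrm{R}}-e_{s-1}^{\mathrm{R}}=-p_s^{\mathrm{R}}/\eta+b_s^{\mathrm{R}}\eta$; $0\le e_s^{\mathrm{R}}\le E$; $p_s^{\mathrm{R}}=0$ whenever $\pi_s<0$, for all $s\in\mathcal{S}$. Admissible sets. $\mathcal{A}^{\mathrm{D}}$ is the nonempty set of admissible day-ahead decisions, each satisfying the day-ahead constraints; $\mathcal{A}^{\mathrm{R}}$ is the nonempty set of admissible real-time decisions, each satisfying the real-time constraints (and whatever information restriction, e.g. non-anticipativity, is imposed). There is no constraint coupling day-ahead and real-time decisions, so the jointly feasible set is $\mathcal{A}^{\mathrm{D}}\times\mathcal{A}^{\mathrm{R}}$. Price-taker assumption. The storage's decisions do not affect the distribution of the prices $\bm{\lambda},\bm{\pi}$, and every day-ahead decision $x^{\mathrm{D}}\in\mathcal{A}^{\mathrm{D}}$ is statistically independent of $\bm{\pi}$. *)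

theory Defs
  imports "HOL-Probability.Probability"
begin

text \<open>
  The day-ahead hours are numbered \<open>1..H\<close> and the real-time intervals \<open>1..N\<close>; index \<open>0\<close> is used
  only for the initial state of charge.  A schedule consists of the discharged energies (first
  component) and the charged energies (second component); both are random, and their values at
  indices outside the horizon play no role.
\<close>

type_synonym 'w schedule = "(nat \<Rightarrow> 'w \<Rightarrow> real) \<times> (nat \<Rightarrow> 'w \<Rightarrow> real)"

abbreviation discharge :: "'w schedule \<Rightarrow> nat \<Rightarrow> 'w \<Rightarrow> real" where
  "discharge \<equiv> fst"

abbreviation charge :: "'w schedule \<Rightarrow> nat \<Rightarrow> 'w \<Rightarrow> real" where
  "charge \<equiv> snd"

text \<open>\<open>pmax\<close> bounds the energy per period, \<open>e\<close> is the state of charge at the end of a period.\<close>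

definition storage_feasible ::
  "'w measure \<Rightarrow> nat \<Rightarrow> real \<Rightarrow> real \<Rightarrow> real \<Rightarrow> real \<Rightarrow> 'w schedule \<Rightarrow> bool" where
  "storage_feasible M n pmax E \<eta> e0 x \<longleftrightarrow>
     (\<forall>k\<in>{1..n}. discharge x k \<in> borel_measurable M \<and> charge x k \<in> borel_measurable M) \<and>
     (\<exists>e :: nat \<Rightarrow> 'w \<Rightarrow> real.
        (\<forall>k\<in>{0..n}. e k \<in> borel_measurable M) \<and>
        (AE \<omega> in M. e 0 \<omega> = e0 \<and>
          (\<forall>k\<in>{1..n}.
             0 \<le> discharge x k \<omega> \<and> discharge x k \<omega> \<le> pmax \<and>
             0 \<le> charge x k \<omega> \<and> charge x k \<omega> \<le> pmax \<and>
             e k \<omega> - e (k - 1) \<omega> = - discharge x k \<omega> / \<eta> + charge x k \<omega> * \<eta> \<and>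
             0 \<le> e k \<omega> \<and> e k \<omega> \<le> E)))"

definition day_ahead_feasible ::
  "'w measure \<Rightarrow> nat \<Rightarrow> real \<Rightarrow> real \<Rightarrow> real \<Rightarrow> real \<Rightarrow> 'w schedule \<Rightarrow> bool" where
  "day_ahead_feasible M H P E \<eta> e0 x \<longleftrightarrow> storage_feasible M H P E \<eta> e0 x"

definition real_time_feasible ::
  "'w measure \<Rightarrow> nat \<Rightarrow> nat \<Rightarrow> (nat \<Rightarrow> 'w \<Rightarrow> real) \<Rightarrow> real \<Rightarrow> real \<Rightarrow> real \<Rightarrow> real \<Rightarrow> 'w schedule \<Rightarrow> bool"
  where
  "real_time_feasible M N S \<pi> P E \<eta> e0 x \<longleftrightarrow>
     storage_feasible M N (P / real S) E \<eta> e0 x \<and>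
     (AE \<omega> in M. \<forall>s\<in>{1..N}. \<pi> s \<omega> < 0 \<longrightarrow> discharge x s \<omega> = 0)"

text \<open>
  Independence of two random elements through the \<open>\<sigma>\<close>-algebras they generate; the library's
  \<open>indep_var\<close> requires both to have the same type, which a price path and a schedule do not.
\<close>

definition indep_rv ::
  "'w measure \<Rightarrow> 'b measure \<Rightarrow> ('w \<Rightarrow> 'b) \<Rightarrow> 'c measure \<Rightarrow> ('w \<Rightarrow> 'c) \<Rightarrow> bool" where
  "indep_rv M MX X MY Y \<longleftrightarrow>
     X \<in> measurable M MX \<and> Y \<in> measurable M MY \<and>
     prob_space.indep_set M {X -` A \<inter> space M | A. A \<in> sets MX} {Y -` B \<inter> space M | B. B \<in> sets MY}"

definition schedule_indep_prices ::
  "'w measure \<Rightarrow> nat \<Rightarrow> nat \<Rightarrow> (nat \<Rightarrow> 'w \<Rightarrow> real) \<Rightarrow> 'w schedule \<Rightarrow> bool" where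
  "schedule_indep_prices M H N \<pi> x \<longleftrightarrow>
     indep_rv M
       (\<Pi>\<^sub>M t\<in>{1..H}. borel \<Otimes>\<^sub>M borel) (\<lambda>\<omega>. \<lambda>t\<in>{1..H}. (discharge x t \<omega>, charge x t \<omega>))
       (\<Pi>\<^sub>M s\<in>{1..N}. borel) (\<lambda>\<omega>. \<lambda>s\<in>{1..N}. \<pi> s \<omega>)"

definition mean_rt_price ::
  "'w measure \<Rightarrow> nat \<Rightarrow> nat \<Rightarrow> (nat \<Rightarrow> nat) \<Rightarrow> (nat \<Rightarrow> 'w \<Rightarrow> real) \<Rightarrow> nat \<Rightarrow> real" where
  "mean_rt_price M N S \<tau> \<pi> t = (\<integral>\<omega>. 1 / real S * (\<Sum>s | s \<in> {1..N} \<and> \<tau> s = t. \<pi> s \<omega>) \<partial>M)"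

definition joint_profit ::
  "'w measure \<Rightarrow> nat \<Rightarrow> nat \<Rightarrow> nat \<Rightarrow> (nat \<Rightarrow> nat) \<Rightarrow> (nat \<Rightarrow> 'w \<Rightarrow> real) \<Rightarrow> (nat \<Rightarrow> 'w \<Rightarrow> real) \<Rightarrow> real
    \<Rightarrow> 'w schedule \<times> 'w schedule \<Rightarrow> real" where
  "joint_profit M H N S \<tau> lam \<pi> c = (\<lambda>(xD, xR). \<integral>\<omega>.
     (\<Sum>t\<in>{1..H}. lam t \<omega> * (discharge xD t \<omega> - charge xD t \<omega>))
     - (\<Sum>s\<in>{1..N}. c * discharge xR s \<omega>)
     + (\<Sum>s\<in>{1..N}. \<pi> s \<omega> * (discharge xR s \<omega> - charge xR s \<omega>
          - discharge xD (\<tau> s) \<omega> / real S + charge xD (\<tau> s) \<omega> / real S)) \<partial>M)"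

definition day_ahead_profit ::
  "'w measure \<Rightarrow> nat \<Rightarrow> nat \<Rightarrow> nat \<Rightarrow> (nat \<Rightarrow> nat) \<Rightarrow> (nat \<Rightarrow> 'w \<Rightarrow> real) \<Rightarrow> (nat \<Rightarrow> 'w \<Rightarrow> real)
    \<Rightarrow> 'w schedule \<Rightarrow> real" where
  "day_ahead_profit M H N S \<tau> lam \<pi> xD = (\<integral>\<omega>.
     (\<Sum>t\<in>{1..H}. lam t \<omega> * (discharge xD t \<omega> - charge xD t \<omega>)
        - mean_rt_price M N S \<tau> \<pi> t * (discharge xD t \<omega> - charge xD t \<omega>)) \<partial>M)"

definition real_time_profit ::
  "'w measure \<Rightarrow> nat \<Rightarrow> (nat \<Rightarrow> 'w \<Rightarrow> real) \<Rightarrow> real \<Rightarrow> 'w schedule \<Rightarrow> real" where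
  "real_time_profit M N \<pi> c xR = (\<integral>\<omega>.
     (\<Sum>s\<in>{1..N}. \<pi> s \<omega> * (discharge xR s \<omega> - charge xR s \<omega>))
     - (\<Sum>s\<in>{1..N}. c * discharge xR s \<omega>) \<partial>M)"

end

theory Submission
  imports Defs
begin

text \<open>
  The coupling term of the joint objective is the expectation of \<open>\<pi>\<^sub>s\<close> times the net day-ahead
  position in hour \<open>\<tau> s\<close>.  By independence it factors into a product of expectations, and grouping
  the intervals by hour turns it into the day-ahead settlement at the mean real-time prices.  The
  joint objective is therefore a day-ahead objective plus a real-time objective; all profits are
  finite because the decisions are bounded and the prices integrable, so maximising a separable
  sum over a product set gives the claim.
\<close>

text \<open>A supremum over pairs is an iterated supremum, and in \<open>ereal\<close> a summand can
  be pulled out of a supremum over a nonempty set as long as it is not \<open>-\<infinity>\<close>.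
  Real values on nonempty index sets ensure this; the value \<open>\<infinity>\<close> does no
  harm.\<close>

lemma SUP_ereal_add_Times:
  fixes f :: "'a \<Rightarrow> real" and g :: "'b \<Rightarrow> real"
  assumes "A \<noteq> {}" "B \<noteq> {}"
  shows "(SUP x\<in>A \<times> B. ereal (f (fst x) + g (snd x))) =
    (SUP a\<in>A. ereal (f a)) + (SUP b\<in>B. ereal (g b))"
proof -
  have ninf: "(SUP b\<in>B. ereal (g b)) \<noteq> -\<infinity>"
    using assms(2) by (auto simp: SUP_eq_iff bot_ereal_def[symmetric] SUP_bot_conv) (simp add: bot_ereal_def)
  have "(SUP x\<in>A \<times> B. ereal (f (fst x) + g (snd x))) = (SUP a\<in>A. SUP b\<in>B. ereal (f a) + ereal (g b))"
    by (rule antisym) (fastforce intro!: SUP_least intro: SUP_upper2)+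
  \<comment> \<open>The two \<open>ereal\<close> terms must stay unmerged so that
    \<open>ereal (f a)\<close> is visible as the constant summand of the inner supremum.\<close>
  also have "\<dots> = (SUP a\<in>A. ereal (f a) + (SUP b\<in>B. ereal (g b)))"
    using assms(2) by (simp add: SUP_ereal_add_right del: plus_ereal.simps)
  also have "\<dots> = (SUP a\<in>A. ereal (f a)) + (SUP b\<in>B. ereal (g b))"
    using assms(1) ninf by (simp add: SUP_ereal_add_left)
  finally show ?thesis .
qed

text \<open>Fixing one coordinate at its optimal value and varying the other cancels the fixed real
  summand; conversely the two inequalities add up. The splitting of \<open>h\<close> is asked for
  only on the product, since the joint profit is shown to split only for admissible
  decisions.\<close>

lemma is_arg_max_add_Times:
  fixes f :: "'a \<Rightarrow> real" and g :: "'b \<Rightarrow> real"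
  assumes "a \<in> A" "b \<in> B"
    and h: "\<And>x y. x \<in> A \<Longrightarrow> y \<in> B \<Longrightarrow> h (x, y) = f x + g y"
  shows "is_arg_max h (\<lambda>x. x \<in> A \<times> B) (a, b) \<longleftrightarrow>
    is_arg_max f (\<lambda>x. x \<in> A) a \<and> is_arg_max g (\<lambda>x. x \<in> B) b"
proof
  assume max: "is_arg_max h (\<lambda>x. x \<in> A \<times> B) (a, b)"
  have "f x \<le> f a" if "x \<in> A" for x
    using max assms that by (fastforce simp: is_arg_max_linorder)
  moreover have "g y \<le> g b" if "y \<in> B" for y
    using max assms that by (fastforce simp: is_arg_max_linorder)
  ultimately show "is_arg_max f (\<lambda>x. x \<in> A) a \<and> is_arg_max g (\<lambda>x. x \<in> B) b"
    using assms by (simp add: is_arg_max_linorder)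
next
  assume "is_arg_max f (\<lambda>x. x \<in> A) a \<and> is_arg_max g (\<lambda>x. x \<in> B) b"
  then show "is_arg_max h (\<lambda>x. x \<in> A \<times> B) (a, b)"
    using assms by (auto simp: is_arg_max_linorder intro: add_mono)
qed

text \<open>A bridge from path-level independence to \<open>indep_var\<close>, where both variables
  share a value type. Events of the composites are already events of \<open>X\<close> and
  \<open>Y\<close>, so they inherit the product rule for probabilities.\<close>

lemma indep_rv_compose:
  assumes "prob_space M" and indep: "indep_rv M MX X MY Y"
    and f: "f \<in> measurable MX K" and g: "g \<in> measurable MY L"
  shows "prob_space.indep_var M K (\<lambda>\<omega>. f (X \<omega>)) L (\<lambda>\<omega>. g (Y \<omega>))"
proof -
  interpret prob_space M by fact
  let ?I = "\<lambda>N Z. {Z -` C \<inter> space M |C. C \<in> sets N}"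
  have X: "X \<in> measurable M MX" and Y: "Y \<in> measurable M MY"
    and XY: "indep_set (?I MX X) (?I MY Y)"
    using indep by (auto simp: indep_rv_def)
  have sub: "sigma_sets (space M) (?I N (\<lambda>\<omega>. h (Z \<omega>))) \<subseteq> ?I N' Z"
    if Z: "Z \<in> measurable M N'" and h: "h \<in> measurable N' N" for Z N' h N
  proof -
    \<comment> \<open>The preimages of a \<sigma>-algebra already form a \<sigma>-algebra, so
      \<open>sigma_sets\<close> adds nothing.\<close>
    have "sigma_sets (space M) (?I N (\<lambda>\<omega>. h (Z \<omega>))) = ?I N (\<lambda>\<omega>. h (Z \<omega>))"
      using measurable_space[OF measurable_compose[OF Z h]]
      by (intro sets_vimage_algebra[symmetric, THEN trans] sets_vimage_algebra2) auto
    also have "\<dots> \<subseteq> ?I N' Z"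
    proof clarify
      fix C assume "C \<in> sets N"
      then have "h -` C \<inter> space N' \<in> sets N'" using h by (rule measurable_sets[rotated])
      moreover have "(\<lambda>\<omega>. h (Z \<omega>)) -` C \<inter> space M = Z -` (h -` C \<inter> space N') \<inter> space M"
        using measurable_space[OF Z] by auto
      ultimately show "\<exists>D. (\<lambda>\<omega>. h (Z \<omega>)) -` C \<inter> space M = Z -` D \<inter> space M \<and> D \<in> sets N'"
        by blast
    qed
    finally show ?thesis .
  qed
  have "indep_set (sigma_sets (space M) (?I K (\<lambda>\<omega>. f (X \<omega>))))
      (sigma_sets (space M) (?I L (\<lambda>\<omega>. g (Y \<omega>))))"
    using XY sub[OF X f] sub[OF Y g] unfolding indep_sets2_eq by (meson subset_eq)
  then show ?thesis
    unfolding indep_var_eq using measurable_compose[OF X f] measurable_compose[OF Y g] by simp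
qed

text \<open>\<open>B * f\<close> dominates the product. This suits prices, which are merely
  integrable, times energies, which the power limits bound almost surely.\<close>

lemma integrable_mult_AE_bounded:
  fixes f g :: "'a \<Rightarrow> real"
  assumes f: "integrable M f" and g: "g \<in> borel_measurable M" and bd: "AE x in M. \<bar>g x\<bar> \<le> B"
  shows "integrable M (\<lambda>x. f x * g x)"
proof (rule Bochner_Integration.integrable_bound)
  show "integrable M (\<lambda>x. B * f x)" using f by simp
  show "(\<lambda>x. f x * g x) \<in> borel_measurable M" using f g by measurable
  show "AE x in M. norm (f x * g x) \<le> norm (B * f x)"
    using bd
  proof eventually_elim
    case (elim x)
    then have "\<bar>f x\<bar> * \<bar>g x\<bar> \<le> \<bar>f x\<bar> * \<bar>B\<bar>" by (intro mult_left_mono) auto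
    then show ?case by (simp add: abs_mult mult.commute)
  qed
qed

lemma storage_feasible_measurable:
  assumes "storage_feasible M n pmax E \<eta> e0 x" "k \<in> {1..n}"
  shows "discharge x k \<in> borel_measurable M" "charge x k \<in> borel_measurable M"
  using assms unfolding storage_feasible_def by blast+

lemma storage_feasible_bounded:
  assumes "storage_feasible M n pmax E \<eta> e0 x" "k \<in> {1..n}"
  shows "AE \<omega> in M. \<bar>discharge x k \<omega>\<bar> \<le> pmax"
    "AE \<omega> in M. \<bar>discharge x k \<omega> - charge x k \<omega>\<bar> \<le> pmax"
proof -
  have *: "AE \<omega> in M. 0 \<le> discharge x k \<omega> \<and> discharge x k \<omega> \<le> pmax \<and>
      0 \<le> charge x k \<omega> \<and> charge x k \<omega> \<le> pmax"
    using assms unfolding storage_feasible_def by (auto elim!: AE_mp)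
  show "AE \<omega> in M. \<bar>discharge x k \<omega>\<bar> \<le> pmax"
    "AE \<omega> in M. \<bar>discharge x k \<omega> - charge x k \<omega>\<bar> \<le> pmax"
    using * by (eventually_elim, linarith)+
qed

text \<open>Only products of a real-time price with a day-ahead position are factored. The products
  \<open>lam t \<omega> * q t \<omega>\<close> and \<open>\<pi> s \<omega> * r s \<omega>\<close>
  stay inside one expectation, so \<open>xD\<close> may depend on \<open>lam\<close> and
  \<open>xR\<close> on \<open>\<pi>\<close>.\<close>

lemma joint_profit_split:
  assumes prob: "prob_space M"
    and hour: "\<And>s. s \<in> {1..N} \<Longrightarrow> \<tau> s \<in> {1..H}"
    and lam: "\<And>t. t \<in> {1..H} \<Longrightarrow> integrable M (lam t)"
    and rt: "\<And>s. s \<in> {1..N} \<Longrightarrow> integrable M (\<pi> s)"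
    and xD: "storage_feasible M H P E \<eta> e0D xD"
    and xR: "storage_feasible M N P' E' \<eta>' e0R xR"
    and indep: "schedule_indep_prices M H N \<pi> xD"
  shows "joint_profit M H N S \<tau> lam \<pi> c (xD, xR) =
    day_ahead_profit M H N S \<tau> lam \<pi> xD + real_time_profit M N \<pi> c xR"
proof -
  interpret prob_space M by fact
  define q where "q t \<omega> = discharge xD t \<omega> - charge xD t \<omega>" for t \<omega>
  define r where "r s \<omega> = discharge xR s \<omega> - charge xR s \<omega>" for s \<omega>
  define p where "p s \<omega> = c * discharge xR s \<omega>" for s \<omega>
  have q_int: "integrable M (\<lambda>\<omega>. f \<omega> * q t \<omega>)" if "integrable M f" "t \<in> {1..H}" for f t
    unfolding q_def using that storage_feasible_measurable[OF xD] storage_feasible_bounded[OF xD]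
    by (intro integrable_mult_AE_bounded[where B=P]) auto
  have r_int: "integrable M (\<lambda>\<omega>. \<pi> s \<omega> * r s \<omega>)" if "s \<in> {1..N}" for s
    unfolding r_def using that rt storage_feasible_measurable[OF xR] storage_feasible_bounded[OF xR]
    by (intro integrable_mult_AE_bounded[where B=P']) auto
  \<comment> \<open>The constant \<open>c\<close> takes the place of the price: constants are
    integrable on a probability space.\<close>
  have p_int: "integrable M (p s)" if "s \<in> {1..N}" for s
    unfolding p_def using that storage_feasible_measurable[OF xR] storage_feasible_bounded[OF xR]
    by (intro integrable_mult_AE_bounded[where B=P']) auto
  have q_int1: "integrable M (q t)" if "t \<in> {1..H}" for t
    using q_int[of "\<lambda>_. 1" t] that by simp
  have factor: "(\<integral>\<omega>. \<pi> s \<omega> * q t \<omega> \<partial>M) = (\<integral>\<omega>. \<pi> s \<omega> \<partial>M) * (\<integral>\<omega>. q t \<omega> \<partial>M)"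
    if s: "s \<in> {1..N}" and t: "t \<in> {1..H}" for s t
  proof -
    \<comment> \<open>Both variables are measurable functions of the paths. As \<open>t\<close> and
      \<open>s\<close> lie in the horizons, evaluating the restricted paths there returns the actual
      values instead of \<open>undefined\<close>.\<close>
    have "(\<lambda>z. fst (z t) - snd (z t)) \<in> borel_measurable (\<Pi>\<^sub>M t\<in>{1..H}. borel \<Otimes>\<^sub>M (borel :: real measure))"
      using t by measurable
    moreover have "(\<lambda>z. z s) \<in> borel_measurable (\<Pi>\<^sub>M s\<in>{1..N}. (borel :: real measure))"
      using s by measurable
    ultimately have "indep_var borel (q t) borel (\<pi> s)"
      using indep_rv_compose[OF prob indep[unfolded schedule_indep_prices_def],
          of "\<lambda>z. fst (z t) - snd (z t)" borel "\<lambda>z. z s" borel] s t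
      by (simp add: q_def[abs_def])
    then show ?thesis
      using indep_var_lebesgue_integral[of "q t" "\<pi> s"] q_int1[OF t] rt[OF s]
      by (simp add: mult.commute)
  qed
  have mean: "mean_rt_price M N S \<tau> \<pi> t = (\<Sum>s | s \<in> {1..N} \<and> \<tau> s = t. (\<integral>\<omega>. \<pi> s \<omega> \<partial>M) / real S)" for t
    unfolding mean_rt_price_def by (simp add: sum_divide_distrib rt Bochner_Integration.integral_sum)
  have "(\<Sum>s\<in>{1..N}. (\<integral>\<omega>. \<pi> s \<omega> * q (\<tau> s) \<omega> \<partial>M) / real S) =
      (\<Sum>s\<in>{1..N}. (\<integral>\<omega>. \<pi> s \<omega> \<partial>M) / real S * (\<integral>\<omega>. q (\<tau> s) \<omega> \<partial>M))"
    using hour by (intro sum.cong refl) (simp add: factor)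
  \<comment> \<open>No interval is lost, since \<open>\<tau>\<close> maps into the hours. Within one
    group \<open>q (\<tau> s)\<close> is \<open>q t\<close> and factors out of the inner
    sum.\<close>
  also have "\<dots> = (\<Sum>t\<in>{1..H}. \<Sum>s | s \<in> {1..N} \<and> \<tau> s = t.
      (\<integral>\<omega>. \<pi> s \<omega> \<partial>M) / real S * (\<integral>\<omega>. q (\<tau> s) \<omega> \<partial>M))"
    using hour by (intro sum.group[symmetric]) auto
  also have "\<dots> = (\<Sum>t\<in>{1..H}. mean_rt_price M N S \<tau> \<pi> t * (\<integral>\<omega>. q t \<omega> \<partial>M))"
    by (intro sum.cong refl) (simp add: mean sum_distrib_right)
  finally have settle: "(\<Sum>s\<in>{1..N}. (\<integral>\<omega>. \<pi> s \<omega> * q (\<tau> s) \<omega> \<partial>M) / real S) =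
      (\<Sum>t\<in>{1..H}. mean_rt_price M N S \<tau> \<pi> t * (\<integral>\<omega>. q t \<omega> \<partial>M))" .
  have "joint_profit M H N S \<tau> lam \<pi> c (xD, xR) =
      (\<integral>\<omega>. (\<Sum>t\<in>{1..H}. lam t \<omega> * q t \<omega>) - (\<Sum>s\<in>{1..N}. p s \<omega>)
        + ((\<Sum>s\<in>{1..N}. \<pi> s \<omega> * r s \<omega>) - (\<Sum>s\<in>{1..N}. \<pi> s \<omega> * q (\<tau> s) \<omega> / real S)) \<partial>M)"
    \<comment> \<open>Merging the last two sums into one over \<open>s\<close> reduces the claim to
      algebra in each interval.\<close>
    unfolding joint_profit_def q_def r_def p_def sum_subtractf[symmetric] prod.case
    by (intro Bochner_Integration.integral_cong arg_cong2[where f="(+)"] sum.cong refl)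
      (simp add: field_simps diff_divide_distrib)
  also have "\<dots> = (\<Sum>t\<in>{1..H}. \<integral>\<omega>. lam t \<omega> * q t \<omega> \<partial>M) - (\<Sum>s\<in>{1..N}. \<integral>\<omega>. p s \<omega> \<partial>M)
      + ((\<Sum>s\<in>{1..N}. \<integral>\<omega>. \<pi> s \<omega> * r s \<omega> \<partial>M)
        - (\<Sum>s\<in>{1..N}. (\<integral>\<omega>. \<pi> s \<omega> * q (\<tau> s) \<omega> \<partial>M) / real S))"
    by (simp only: Bochner_Integration.integral_diff Bochner_Integration.integral_add
        Bochner_Integration.integrable_diff Bochner_Integration.integral_sum
        Bochner_Integration.integrable_sum integral_divide_zero Bochner_Integration.integrable_divide
        q_int[OF lam] q_int[OF rt hour] r_int p_int)
  \<comment> \<open>The mean real-time price is a number, so it leaves the day-ahead expectation,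
    and linearity brings the right-hand side to the same sums of expectations.\<close>
  also have "\<dots> = day_ahead_profit M H N S \<tau> lam \<pi> xD + real_time_profit M N \<pi> c xR"
    unfolding settle day_ahead_profit_def real_time_profit_def q_def[symmetric] r_def[symmetric] p_def[symmetric]
    by (simp only: Bochner_Integration.integral_diff Bochner_Integration.integrable_diff
        Bochner_Integration.integral_sum Bochner_Integration.integrable_sum sum_subtractf
        integral_mult_right_zero Bochner_Integration.integrable_mult_right
        q_int[OF lam] q_int1 r_int p_int)
  finally show ?thesis .
qed

theorem proposition2:
  fixes M :: "'w measure"
    and H N S :: nat
    and \<tau> :: "nat \<Rightarrow> nat"
    and lam \<pi> :: "nat \<Rightarrow> 'w \<Rightarrow> real"
    and c P E \<eta> e0D e0R :: real
    and AD AR :: "'w schedule set"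
  assumes prob: "prob_space M"
    and S_pos: "S \<ge> 1"
    and hour: "\<And>s. s \<in> {1..N} \<Longrightarrow> \<tau> s \<in> {1..H}"
    and hour_card: "\<And>t. t \<in> {1..H} \<Longrightarrow> card {s \<in> {1..N}. \<tau> s = t} = S"
    and lam_integrable: "\<And>t. t \<in> {1..H} \<Longrightarrow> integrable M (lam t)"
    and rt_integrable: "\<And>s. s \<in> {1..N} \<Longrightarrow> integrable M (\<pi> s)"
    and P_pos: "P > 0" and E_pos: "E > 0"
    and eff: "0 < \<eta>" "\<eta> \<le> 1"
    and e0D: "e0D \<in> {0..E}" and e0R: "e0R \<in> {0..E}"
    and AD_nonempty: "AD \<noteq> {}"
    and AD_feasible: "\<And>xD. xD \<in> AD \<Longrightarrow> day_ahead_feasible M H P E \<eta> e0D xD"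
    and AR_nonempty: "AR \<noteq> {}"
    and AR_feasible: "\<And>xR. xR \<in> AR \<Longrightarrow> real_time_feasible M N S \<pi> P E \<eta> e0R xR"
    and price_taker: "\<And>xD. xD \<in> AD \<Longrightarrow> schedule_indep_prices M H N \<pi> xD"
  shows "(SUP x\<in>AD \<times> AR. ereal (joint_profit M H N S \<tau> lam \<pi> c x)) =
           (SUP xD\<in>AD. ereal (day_ahead_profit M H N S \<tau> lam \<pi> xD)) +
           (SUP xR\<in>AR. ereal (real_time_profit M N \<pi> c xR)) \<and>
         (\<forall>xD\<in>AD. \<forall>xR\<in>AR.
           is_arg_max (joint_profit M H N S \<tau> lam \<pi> c) (\<lambda>x. x \<in> AD \<times> AR) (xD, xR) \<longleftrightarrow>
           is_arg_max (day_ahead_profit M H N S \<tau> lam \<pi>) (\<lambda>x. x \<in> AD) xD \<and>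
           is_arg_max (real_time_profit M N \<pi> c) (\<lambda>x. x \<in> AR) xR)"
proof -
  have split: "joint_profit M H N S \<tau> lam \<pi> c (xD, xR) =
      day_ahead_profit M H N S \<tau> lam \<pi> xD + real_time_profit M N \<pi> c xR"
    if "xD \<in> AD" "xR \<in> AR" for xD xR
    using joint_profit_split[OF prob hour lam_integrable rt_integrable
        AD_feasible[OF that(1), unfolded day_ahead_feasible_def]
        AR_feasible[OF that(2), unfolded real_time_feasible_def, THEN conjunct1]
        price_taker[OF that(1)]] .
  have "(SUP x\<in>AD \<times> AR. ereal (joint_profit M H N S \<tau> lam \<pi> c x)) =
      (SUP x\<in>AD \<times> AR. ereal (day_ahead_profit M H N S \<tau> lam \<pi> (fst x) + real_time_profit M N \<pi> c (snd x)))"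
    by (intro SUP_cong refl) (auto simp: split)
  also have "\<dots> = (SUP xD\<in>AD. ereal (day_ahead_profit M H N S \<tau> lam \<pi> xD)) +
      (SUP xR\<in>AR. ereal (real_time_profit M N \<pi> c xR))"
    by (rule SUP_ereal_add_Times[OF AD_nonempty AR_nonempty])
  finally show ?thesis
    using is_arg_max_add_Times[where h="joint_profit M H N S \<tau> lam \<pi> c", OF _ _ split] by blast
qed

end
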